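(* Let $\mathbf{F}_q$ be a finite field of characteristic $p\neq 2$ and let $n$ be a positive integer with $(n,p)\neq(3,3)$. Then the Lie algebra $\mathfrak{sl}_n(\mathbf{F}_q)$ is $2$-generated.
   Context: $\mathfrak{sl}_n(\mathbf{F}_q)$ is the Lie algebra over $\mathbf{F}_q$ of traceless $n\times n$ matrices with bracket $[x,y]=xy-yx$. A Lie algebra over $\mathbf{F}_q$ is $2$-generated if there are two elements such that the smallest Lie subalgebra over $\mathbf{F}_q$ containing them is the whole algebra. *)

theory Defs
  imports "Jordan_Normal_Form.Matrix" "HOL-Computational_Algebra.Primes"
begin

definition mat_trace :: "'a::comm_monoid_add mat \<Rightarrow> 'a" where
  "mat_trace A = (\<Sum>i<dim_row A. A $$ (i, i))"

definition lie_bracket :: "'a::ring mat \<Rightarrow> 'a mat \<Rightarrow> 'a mat" where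
  "lie_bracket A B = A * B - B * A"

text \<open>The scalars are the whole ground field, so this is closure over \<open>F\<close> and not merely
  over its prime field.\<close>

definition lie_subalgebra :: "nat \<Rightarrow> 'a::field mat set \<Rightarrow> bool" where
  "lie_subalgebra n S \<longleftrightarrow>
     S \<subseteq> carrier_mat n n \<and>
     0\<^sub>m n n \<in> S \<and>
     (\<forall>A\<in>S. \<forall>B\<in>S. A + B \<in> S) \<and>
     (\<forall>c. \<forall>A\<in>S. c \<cdot>\<^sub>m A \<in> S) \<and>
     (\<forall>A\<in>S. \<forall>B\<in>S. lie_bracket A B \<in> S)"

text \<open>For a Lie algebra \<open>L\<close> of \<open>n \<times> n\<close> matrices and \<open>X \<subseteq> L\<close>, the smallest Lie subalgebra
  of \<open>L\<close> containing \<open>X\<close>.\<close>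

definition lie_generated :: "nat \<Rightarrow> 'a::field mat set \<Rightarrow> 'a mat set \<Rightarrow> 'a mat set" where
  "lie_generated n L X = \<Inter>{S. lie_subalgebra n S \<and> S \<subseteq> L \<and> X \<subseteq> S}"

definition two_generated :: "nat \<Rightarrow> 'a::field mat set \<Rightarrow> bool" where
  "two_generated n L \<longleftrightarrow> (\<exists>x\<in>L. \<exists>y\<in>L. lie_generated n L {x, y} = L)"

definition sl :: "nat \<Rightarrow> 'a::field mat set" where
  "sl n = {A \<in> carrier_mat n n. mat_trace A = 0}"

lemma mat_trace_mult_commute:
  fixes A B :: "'a::field mat"
  assumes "A \<in> carrier_mat n n" "B \<in> carrier_mat n n"
  shows "mat_trace (A * B) = mat_trace (B * A)"
proof -
  have "mat_trace (A * B) = (\<Sum>i<n. \<Sum>j<n. A $$ (i, j) * B $$ (j, i))"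
    using assms by (auto simp: mat_trace_def scalar_prod_def lessThan_atLeast0 intro!: sum.cong)
  also have "\<dots> = (\<Sum>j<n. \<Sum>i<n. B $$ (j, i) * A $$ (i, j))"
    by (subst sum.swap) (simp add: mult.commute)
  also have "\<dots> = mat_trace (B * A)"
    using assms by (auto simp: mat_trace_def scalar_prod_def lessThan_atLeast0 intro!: sum.cong)
  finally show ?thesis .
qed

lemma lie_subalgebra_sl: "lie_subalgebra n (sl n :: 'a::field mat set)"
proof -
  have bracket: "lie_bracket A B \<in> sl n" if "A \<in> sl n" "B \<in> sl n" for A B :: "'a mat"
  proof -
    have AB: "A \<in> carrier_mat n n" "B \<in> carrier_mat n n"
      using that by (auto simp: sl_def)
    then have carrier: "lie_bracket A B \<in> carrier_mat n n"
      unfolding lie_bracket_def by (intro minus_carrier_mat mult_carrier_mat) auto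
    have "mat_trace (lie_bracket A B) = (\<Sum>i<n. (A * B) $$ (i, i) - (B * A) $$ (i, i))"
      using AB unfolding mat_trace_def lie_bracket_def
      by (intro sum.cong) (simp_all del: index_mult_mat(1))
    also have "\<dots> = mat_trace (A * B) - mat_trace (B * A)"
      using AB by (simp add: mat_trace_def sum_subtractf del: index_mult_mat(1))
    also have "\<dots> = 0"
      using mat_trace_mult_commute[OF AB] by simp
    finally show ?thesis
      using carrier by (simp add: sl_def)
  qed
  have add: "A + B \<in> sl n" if "A \<in> sl n" "B \<in> sl n" for A B :: "'a mat"
  proof -
    have AB: "A \<in> carrier_mat n n" "B \<in> carrier_mat n n"
      using that by (auto simp: sl_def)
    have "mat_trace (A + B) = (\<Sum>i<n. A $$ (i, i) + B $$ (i, i))"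
      using AB by (auto simp: mat_trace_def intro!: sum.cong)
    also have "\<dots> = mat_trace A + mat_trace B"
      using AB by (simp add: mat_trace_def sum.distrib)
    finally show ?thesis
      using that AB by (simp add: sl_def)
  qed
  have smult: "c \<cdot>\<^sub>m A \<in> sl n" if "A \<in> sl n" for c and A :: "'a mat"
  proof -
    have A: "A \<in> carrier_mat n n"
      using that by (auto simp: sl_def)
    have "mat_trace (c \<cdot>\<^sub>m A) = (\<Sum>i<n. c * A $$ (i, i))"
      using A by (auto simp: mat_trace_def intro!: sum.cong)
    also have "\<dots> = c * mat_trace A"
      using A by (simp add: mat_trace_def sum_distrib_left)
    finally show ?thesis
      using that A by (simp add: sl_def)
  qed
  have zero: "0\<^sub>m n n \<in> (sl n :: 'a mat set)"
    by (simp add: sl_def mat_trace_def)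
  show ?thesis
    unfolding lie_subalgebra_def
    by (intro conjI ballI allI add smult zero bracket) (auto simp: sl_def)
qed

lemma lie_subalgebra_lie_generated:
  assumes "lie_subalgebra n L" "X \<subseteq> L"
  shows "lie_subalgebra n (lie_generated n L X)"
  unfolding lie_subalgebra_def
proof (intro conjI ballI allI)
  show "lie_generated n L X \<subseteq> carrier_mat n n"
    using assms unfolding lie_generated_def lie_subalgebra_def by blast
qed (simp_all add: lie_generated_def lie_subalgebra_def)

end

theory Submission
  imports Defs
begin

text \<open>
  Take \<open>y\<close> diagonal, with entries \<open>d i\<close>. Then \<open>ad y\<close> multiplies the \<open>(i, j)\<close> entry of a matrix by
  its weight \<open>d i - d j\<close>. If the nonzero entries of \<open>x\<close> have only the weights \<open>-1\<close>, \<open>0\<close>, \<open>1\<close>,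
  which are distinct because the characteristic is not \<open>2\<close>, then the three weight components of
  \<open>x\<close> are linear combinations of \<open>x\<close>, \<open>[y, x]\<close> and \<open>[y, [y, x]]\<close>
  (\<open>weight_components\<close>). So a subalgebra that contains \<open>x\<close> and \<open>y\<close> contains
  several sparse matrices, whatever the size of the field.

  Write \<open>E i j\<close> for the matrix units, with indices from \<open>0\<close> to \<open>n - 1\<close>. The \<open>E 0 j\<close>
  and \<open>E j 0\<close> with \<open>j > 0\<close> generate \<open>sl n\<close> (\<open>star_generates_sl\<close>), so it suffices to
  reach all of them. The weight-zero component of \<open>x\<close> will be the nilpotent
  \<open>N k = (\<Sum>i\<ge>k. E i (i + 1))\<close>: bracketing with it moves \<open>E 0 j\<close> to \<open>E 0 (j + 1)\<close>
  and \<open>E (i + 1) 0\<close> to \<open>- E i 0\<close> (\<open>shift_right\<close>, \<open>shift_left\<close>).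

  If \<open>n \<noteq> 0\<close> in the field, let \<open>y = E 0 0 - I / n\<close> and let \<open>x = E 0 1 + N 1 + E (n - 1) 0\<close>
  be the cyclic permutation matrix. Its weight components \<open>E 0 1\<close>, \<open>N 1\<close>, \<open>E (n - 1) 0\<close>
  give the whole star by shifting.

  If the characteristic divides \<open>n\<close>, then a traceless \<open>y\<close> with the same action does not
  exist. For \<open>n \<ge> 5\<close> let \<open>y = E 0 0 - E 1 1\<close> and \<open>x = N 2 + U + V\<close>
  with \<open>U = E 0 2 + E 2 1\<close> of weight \<open>1\<close> and \<open>V = E 1 (n - 1) + E (n - 1) 0\<close> of weight \<open>-1\<close>.
  The nilpotent kills the second summand of \<open>U\<close> and the first of \<open>V\<close>, which leaves \<open>E 0 3\<close>
  and, up to sign, \<open>E (n - 2) 0\<close>. Shifting gives \<open>E 3 0\<close>, and the bracket \<open>E 0 0 - E 3 3\<close> of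
  \<open>E 0 3\<close> and \<open>E 3 0\<close> separates the two summands of \<open>U\<close> and of \<open>V\<close>. Finally
  \<open>[E 0 2, E 2 1] = E 0 1\<close> and \<open>[E 1 (n - 1), E (n - 1) 0] = E 1 0\<close>.

  These two cases cover everything: an odd prime that divides some \<open>n \<le> 4\<close> is \<open>3\<close>, with \<open>n = 3\<close>.
\<close>

section \<open>Matrix units, shifts and their brackets\<close>

definition mat_unit :: "nat \<Rightarrow> nat \<Rightarrow> nat \<Rightarrow> 'a::field mat" where
  "mat_unit n i j = mat n n (\<lambda>(a, b). if a = i \<and> b = j then 1 else 0)"

text \<open>The single nilpotent Jordan block on the indices \<open>k, \<dots>, n - 1\<close>, zero elsewhere.\<close>

definition shift_mat :: "nat \<Rightarrow> nat \<Rightarrow> 'a::field mat" where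
  "shift_mat n k = mat n n (\<lambda>(i, j). if k \<le> i \<and> j = Suc i then 1 else 0)"

lemma mat_unit_carrier [simp]: "mat_unit n i j \<in> carrier_mat n n"
  and shift_mat_carrier [simp]: "shift_mat n k \<in> carrier_mat n n"
  by (simp_all add: mat_unit_def shift_mat_def)

lemma mat_unit_dim [simp]: "dim_row (mat_unit n i j) = n" "dim_col (mat_unit n i j) = n"
  and shift_mat_dim [simp]: "dim_row (shift_mat n k) = n" "dim_col (shift_mat n k) = n"
  and mat_diag_dims [simp]: "dim_row (mat_diag n d) = n" "dim_col (mat_diag n d) = n"
  by (simp_all add: mat_unit_def shift_mat_def mat_diag_def)

lemma lie_bracket_dim [simp]:
  "dim_row (lie_bracket A B) = dim_row B" "dim_col (lie_bracket A B) = dim_col A"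
  by (simp_all add: lie_bracket_def)

lemma lie_bracket_mat_unit_index:
  fixes A :: "'a::field mat"
  assumes "A \<in> carrier_mat n n" "a < n" "b < n" "i < n" "j < n"
  shows "lie_bracket (mat_unit n i j) A $$ (a, b) =
    (if a = i then A $$ (j, b) else 0) - (if b = j then A $$ (a, i) else 0)"
proof -
  have "(mat_unit n i j * A) $$ (a, b) = (\<Sum>k<n. (if k = j then if a = i then A $$ (j, b) else 0 else 0))"
    using assms
    by (auto simp: mat_unit_def scalar_prod_def lessThan_atLeast0 simp del: sum.delta sum.delta' intro!: sum.cong)
  moreover have "(A * mat_unit n i j) $$ (a, b) = (\<Sum>k<n. (if k = i then if b = j then A $$ (a, i) else 0 else 0))"
    using assms
    by (auto simp: mat_unit_def scalar_prod_def lessThan_atLeast0 simp del: sum.delta sum.delta' intro!: sum.cong)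
  ultimately show ?thesis
    using assms unfolding lie_bracket_def by (subst index_minus_mat) (auto simp: mat_unit_def)
qed

lemma lie_bracket_add_left:
  fixes A B C :: "'a::field mat"
  assumes "A \<in> carrier_mat n n" "B \<in> carrier_mat n n" "C \<in> carrier_mat n n"
  shows "lie_bracket (A + B) C = lie_bracket A C + lie_bracket B C"
  using assms unfolding lie_bracket_def
  by (simp add: add_mult_distrib_mat mult_add_distrib_mat) (intro eq_matI; auto)

lemma lie_bracket_diagonal_index:
  fixes A :: "'a::field mat"
  assumes "A \<in> carrier_mat n n" "a < n" "b < n"
  shows "lie_bracket (mat_diag n d) A $$ (a, b) = (d a - d b) * A $$ (a, b)"
  using assms unfolding lie_bracket_def
  by (simp add: mat_diag_mult_left[of _ n n] mat_diag_mult_right[of _ n n] algebra_simps)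

section \<open>Weight components in a subalgebra\<close>

lemma
  assumes "lie_subalgebra n S"
  shows subalgebra_zero: "0\<^sub>m n n \<in> S"
    and subalgebra_add: "A \<in> S \<Longrightarrow> B \<in> S \<Longrightarrow> A + B \<in> S"
    and subalgebra_smult: "A \<in> S \<Longrightarrow> c \<cdot>\<^sub>m A \<in> S"
    and subalgebra_bracket: "A \<in> S \<Longrightarrow> B \<in> S \<Longrightarrow> lie_bracket A B \<in> S"
    and subalgebra_carrier: "A \<in> S \<Longrightarrow> A \<in> carrier_mat n n"
  using assms unfolding lie_subalgebra_def by blast+

lemma subalgebra_minus:
  fixes A B :: "'a::field mat"
  assumes S: "lie_subalgebra n S" and A: "A \<in> S" and B: "B \<in> S"
  shows "A - B \<in> S"
proof -
  have "A - B = A + (-1) \<cdot>\<^sub>m B"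
    using subalgebra_carrier[OF S A] subalgebra_carrier[OF S B] by (intro eq_matI) auto
  then show ?thesis
    using subalgebra_add[OF S A subalgebra_smult[OF S B]] by simp
qed

text \<open>
  On an entry of weight \<open>t \<in> {-1, 0, 1}\<close> the operator \<open>ad (mat_diag n d)\<close> acts as \<open>t\<close>, so
  the polynomials \<open>(t\<^sup>2 + t) / 2\<close>, \<open>(t\<^sup>2 - t) / 2\<close> and \<open>1 - t\<^sup>2\<close> in it are the projections to
  weight \<open>1\<close>, \<open>-1\<close> and \<open>0\<close>. This is where characteristic \<open>2\<close> must be excluded.
\<close>

lemma weight_components:
  fixes d :: "nat \<Rightarrow> 'a::field"
  assumes S: "lie_subalgebra n S" and two: "(2::'a) \<noteq> 0"
    and y: "mat_diag n d \<in> S" and x: "X \<in> S"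
    and weights: "\<And>i j. i < n \<Longrightarrow> j < n \<Longrightarrow> X $$ (i, j) \<noteq> 0 \<Longrightarrow> d i - d j \<in> {-1, 0, 1}"
    and w: "w \<in> {-1, 0, 1}"
  shows "mat n n (\<lambda>(i, j). if d i - d j = w then X $$ (i, j) else 0) \<in> S"
proof -
  define comp where "comp w = mat n n (\<lambda>(i, j). if d i - d j = w then X $$ (i, j) else 0)" for w
  define X1 where "X1 = lie_bracket (mat_diag n d) X"
  define X2 where "X2 = lie_bracket (mat_diag n d) X1"
  have X: "X \<in> carrier_mat n n"
    by (rule subalgebra_carrier[OF S x])
  have X1: "X1 \<in> S" and X2: "X2 \<in> S"
    unfolding X1_def X2_def by (intro subalgebra_bracket[OF S] y x)+
  have X1c: "X1 \<in> carrier_mat n n" and X2c: "X2 \<in> carrier_mat n n"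
    using X1 X2 by (auto intro: subalgebra_carrier[OF S])
  have X1_index: "X1 $$ (i, j) = (d i - d j) * X $$ (i, j)" if "i < n" "j < n" for i j
    using that X by (simp add: X1_def lie_bracket_diagonal_index)
  have X2_index: "X2 $$ (i, j) = (d i - d j) * ((d i - d j) * X $$ (i, j))" if "i < n" "j < n" for i j
    using that X1c by (simp add: X2_def lie_bracket_diagonal_index X1_index)
  have neq: "(1::'a) \<noteq> -1"
    using two by (metis add.right_inverse one_add_one)
  have half: "inverse (2::'a) * (t + t) = t" for t
    using two by (simp flip: mult_2)
  have plus: "comp 1 = inverse 2 \<cdot>\<^sub>m (X2 + X1)"
  proof (rule eq_matI)
    fix i j assume "i < dim_row (inverse 2 \<cdot>\<^sub>m (X2 + X1))" "j < dim_col (inverse 2 \<cdot>\<^sub>m (X2 + X1))"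
    then have ij: "i < n" "j < n"
      using X1c by auto
    show "comp 1 $$ (i, j) = (inverse 2 \<cdot>\<^sub>m (X2 + X1)) $$ (i, j)"
      using weights[OF ij] ij X1c X2c neq neq[symmetric] half[of "X $$ (i, j)"]
      by (cases "X $$ (i, j) = 0") (auto simp: comp_def X1_index X2_index)
  qed (use X1c X2c in \<open>auto simp: comp_def\<close>)
  have minus: "comp (-1) = inverse 2 \<cdot>\<^sub>m (X2 - X1)"
  proof (rule eq_matI)
    fix i j assume "i < dim_row (inverse 2 \<cdot>\<^sub>m (X2 - X1))" "j < dim_col (inverse 2 \<cdot>\<^sub>m (X2 - X1))"
    then have ij: "i < n" "j < n"
      using X1c by auto
    show "comp (-1) $$ (i, j) = (inverse 2 \<cdot>\<^sub>m (X2 - X1)) $$ (i, j)"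
      using weights[OF ij] ij X1c X2c neq neq[symmetric] half[of "X $$ (i, j)"]
      by (cases "X $$ (i, j) = 0") (auto simp: comp_def X1_index X2_index)
  qed (use X1c X2c in \<open>auto simp: comp_def\<close>)
  have zero: "comp 0 = X - X2"
  proof (rule eq_matI)
    fix i j assume "i < dim_row (X - X2)" "j < dim_col (X - X2)"
    then have ij: "i < n" "j < n"
      using X2c by auto
    show "comp 0 $$ (i, j) = (X - X2) $$ (i, j)"
      using weights[OF ij] ij X X2c
      by (cases "X $$ (i, j) = 0") (auto simp: comp_def X2_index)
  qed (use X X2c in \<open>auto simp: comp_def\<close>)
  have "comp w \<in> S"
    using w x X1 X2 plus minus zero
    by (auto intro!: subalgebra_smult[OF S] subalgebra_add[OF S] subalgebra_minus[OF S])
  then show ?thesis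
    by (simp add: comp_def)
qed

section \<open>Reaching and using the star of matrix units\<close>

text \<open>
  Row \<open>0\<close> of \<open>shift_mat n k\<close> vanishes for \<open>k > 0\<close>, and so does its column \<open>0\<close>. Hence in each
  bracket below only one of the two products survives, and it is a single matrix unit.
\<close>

lemma shift_right:
  fixes S :: "'a::field mat set"
  assumes S: "lie_subalgebra n S" and N: "shift_mat n k \<in> S" and "0 < k" "k \<le> m"
    and start: "mat_unit n 0 m \<in> S" and "m \<le> j" "j < n"
  shows "mat_unit n 0 j \<in> S"
  using \<open>m \<le> j\<close> \<open>j < n\<close>
proof (induction j rule: dec_induct)
  case base
  show ?case by (rule start)
next
  case (step j)
  have "lie_bracket (mat_unit n 0 j) (shift_mat n k) = (mat_unit n 0 (Suc j) :: 'a mat)"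
    using step assms(3,4)
    by (intro eq_matI) (simp_all add: lie_bracket_mat_unit_index, auto simp: shift_mat_def mat_unit_def)
  then show ?case
    using subalgebra_bracket[OF S step.IH N] step.prems by simp
qed

lemma shift_left:
  fixes S :: "'a::field mat set"
  assumes S: "lie_subalgebra n S" and N: "shift_mat n k \<in> S" and "0 < k" "m < n"
    and start: "mat_unit n m 0 \<in> S" and "i \<le> m" "k \<le> i"
  shows "mat_unit n i 0 \<in> S"
  using \<open>i \<le> m\<close> \<open>k \<le> i\<close>
proof (induction i rule: inc_induct)
  case base
  show ?case by (rule start)
next
  case (step i)
  have "(-1) \<cdot>\<^sub>m lie_bracket (mat_unit n (Suc i) 0) (shift_mat n k) = (mat_unit n i 0 :: 'a mat)"
    using step assms(3,4)
    by (intro eq_matI) (simp_all add: lie_bracket_mat_unit_index, auto simp: shift_mat_def mat_unit_def)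
  then show ?case
    using subalgebra_smult[OF S subalgebra_bracket[OF S step.IH N]] step.prems 
    by (metis le_SucI)
qed

text \<open>
  The brackets \<open>[E i 0, E 0 j]\<close> give the off-diagonal units \<open>E i j\<close>, and for \<open>i = j = k\<close> they
  give \<open>E k k - E 0 0\<close>; together these span \<open>sl n\<close>. The spanning is proved by building up a
  traceless matrix one entry at a time, keeping the trace zero through the entry at \<open>(0, 0)\<close>.
\<close>

lemma star_generates_sl:
  fixes S :: "'a::field mat set"
  assumes S: "lie_subalgebra n S"
    and row: "\<And>j. 0 < j \<Longrightarrow> j < n \<Longrightarrow> mat_unit n 0 j \<in> S"
    and col: "\<And>i. 0 < i \<Longrightarrow> i < n \<Longrightarrow> mat_unit n i 0 \<in> S"
  shows "sl n \<subseteq> S"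
proof
  fix A :: "'a mat"
  assume "A \<in> sl n"
  then have A: "A \<in> carrier_mat n n" and tr: "(\<Sum>k<n. A $$ (k, k)) = 0"
    by (auto simp: sl_def mat_trace_def)
  have off: "mat_unit n i j \<in> S" if ij: "i < n" "j < n" "i \<noteq> j" for i j
  proof (cases "i = 0 \<or> j = 0")
    case True
    then show ?thesis
      using ij row col by auto
  next
    case False
    have "lie_bracket (mat_unit n i 0) (mat_unit n 0 j) = (mat_unit n i j :: 'a mat)"
      using False ij
      by (intro eq_matI) (simp_all add: lie_bracket_mat_unit_index, auto simp: mat_unit_def)
    then show ?thesis
      using False ij subalgebra_bracket[OF S col row] by (metis neq0_conv)
  qed
  have diff: "lie_bracket (mat_unit n k 0) (mat_unit n 0 k) \<in> S" if "0 < k" "k < n" for k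
    using that by (intro subalgebra_bracket[OF S] row col)
  have off_part: "mat n n (\<lambda>p. if p \<in> P then A $$ p else 0) \<in> S"
    if "finite P" "P \<subseteq> {..<n} \<times> {..<n} - Id" for P
    using that
  proof (induction P)
    case empty
    have "mat n n (\<lambda>p. if p \<in> {} then A $$ p else 0) = 0\<^sub>m n n"
      by (intro eq_matI) auto
    then show ?case
      using subalgebra_zero[OF S] by simp
  next
    case (insert p P)
    obtain i j where p: "p = (i, j)" by (cases p)
    have "mat n n (\<lambda>q. if q \<in> insert p P then A $$ q else 0) =
        mat n n (\<lambda>q. if q \<in> P then A $$ q else 0) + A $$ (i, j) \<cdot>\<^sub>m mat_unit n i j"
      using insert.hyps p by (intro eq_matI) (auto simp: mat_unit_def)
    then show ?case
      using insert p by (auto intro!: subalgebra_add[OF S] subalgebra_smult[OF S] off)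
  qed
  have diag_part: "mat_diag n (\<lambda>i. if i \<in> K then A $$ (i, i) else if i = 0 then - (\<Sum>k\<in>K. A $$ (k, k)) else 0) \<in> S"
    if "finite K" "K \<subseteq> {0<..<n}" for K
    using that
  proof (induction K)
    case empty
    have "mat_diag n (\<lambda>i. if i \<in> {} then A $$ (i, i) else if i = 0 then - (\<Sum>k\<in>{}. A $$ (k, k)) else 0) = 0\<^sub>m n n"
      by (intro eq_matI) (auto simp: mat_diag_def)
    then show ?case
      using subalgebra_zero[OF S] by simp
  next
    case (insert k K)
    have k: "0 < k" "k < n" "k \<notin> K" "0 \<notin> K"
      using insert by auto
    have "mat_diag n (\<lambda>i. if i \<in> insert k K then A $$ (i, i)
          else if i = 0 then - (\<Sum>k\<in>insert k K. A $$ (k, k)) else 0) =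
        mat_diag n (\<lambda>i. if i \<in> K then A $$ (i, i) else if i = 0 then - (\<Sum>k\<in>K. A $$ (k, k)) else 0)
        + A $$ (k, k) \<cdot>\<^sub>m lie_bracket (mat_unit n k 0) (mat_unit n 0 k)"
      using k insert.hyps
      by (intro eq_matI) (simp_all add: lie_bracket_mat_unit_index, auto simp: mat_unit_def mat_diag_def)
    then show ?case
      using insert k by (auto intro!: subalgebra_add[OF S] subalgebra_smult[OF S] diff)
  qed
  have A00: "A $$ (0, 0) = - (\<Sum>k\<in>{0<..<n}. A $$ (k, k))" if "0 < n"
  proof -
    have "{..<n} = insert 0 {0<..<n}" using that by auto
    then show ?thesis
      using tr by (simp add: eq_neg_iff_add_eq_0)
  qed
  have "A = mat n n (\<lambda>p. if p \<in> {..<n} \<times> {..<n} - Id then A $$ p else 0)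
     + mat_diag n (\<lambda>i. if i \<in> {0<..<n} then A $$ (i, i)
          else if i = 0 then - (\<Sum>k\<in>{0<..<n}. A $$ (k, k)) else 0)"
    using A A00 by (intro eq_matI) (auto simp: mat_diag_def)
  also have "\<dots> \<in> S"
    by (intro subalgebra_add[OF S] off_part diag_part) auto
  finally show "A \<in> S" .
qed

section \<open>Generating pairs\<close>

lemma two_generatedI:
  assumes "lie_subalgebra n L" "x \<in> L" "y \<in> L"
    and "\<And>S. lie_subalgebra n S \<Longrightarrow> x \<in> S \<Longrightarrow> y \<in> S \<Longrightarrow> L \<subseteq> S"
  shows "two_generated n L"
  using assms unfolding two_generated_def lie_generated_def
  by (intro bexI[of _ x] bexI[of _ y]) auto

lemma mat_trace_diagonal: "mat_trace (mat_diag n d) = (\<Sum>i<n. d i)"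
  unfolding mat_trace_def by (auto simp: mat_diag_def intro!: sum.cong)

text \<open>
  The matrix \<open>E 0 0\<close> has the wanted weights, and dividing by \<open>n\<close> makes it traceless by subtracting
  a scalar, which does not change the weights. In the cyclic permutation matrix the one nonzero
  entry of row \<open>0\<close> then has weight \<open>1\<close>, and the one of column \<open>0\<close> has weight \<open>-1\<close>.
\<close>

lemma two_generated_sl_of_degree_nonzero:
  assumes two: "(2::'a::field) \<noteq> 0" and deg: "of_nat n \<noteq> (0::'a)"
  shows "two_generated n (sl n :: 'a mat set)"
proof (cases "n = 1")
  case True
  show ?thesis
  proof (rule two_generatedI[OF lie_subalgebra_sl])
    \<comment> \<open>For \<open>n = 1\<close> the star is empty and the algebra is zero.\<close>
    show "sl n \<subseteq> S" if "lie_subalgebra n S" for S :: "'a mat set"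
      using that True by (intro star_generates_sl) auto
  qed (rule subalgebra_zero[OF lie_subalgebra_sl])+
next
  case False
  then have n: "2 \<le> n"
    using deg by (cases n) auto
  define d :: "nat \<Rightarrow> 'a" where "d i = of_bool (i = 0) - 1 / of_nat n" for i
  define X :: "'a mat" where
    "X = mat n n (\<lambda>(i, j). if j = Suc i \<or> i = n - 1 \<and> j = 0 then 1 else 0)"
  show ?thesis
  proof (rule two_generatedI[OF lie_subalgebra_sl])
    show "X \<in> sl n"
      using n by (auto simp: X_def sl_def mat_trace_def intro!: sum.neutral)
    have "(\<Sum>i<n. d i) = 0"
      using n deg by (simp add: d_def sum_subtractf of_bool_def)
    then show "mat_diag n d \<in> sl n"
      by (simp add: sl_def mat_trace_diagonal)
    show "sl n \<subseteq> S" if S: "lie_subalgebra n S" and x: "X \<in> S" and y: "mat_diag n d \<in> S" for S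
    proof -
      have comp: "mat n n (\<lambda>(i, j). if d i - d j = w then X $$ (i, j) else 0) \<in> S"
        if "w \<in> {-1, 0, 1}" for w
        using that by (intro weight_components[OF S two y x]) (auto simp: d_def)
      have neq: "(1::'a) \<noteq> -1"
        using two by (metis add.right_inverse one_add_one)
      have "mat n n (\<lambda>(i, j). if d i - d j = 1 then X $$ (i, j) else 0) = mat_unit n 0 1"
        using n neq neq[symmetric] by (intro eq_matI) (auto simp: X_def mat_unit_def d_def of_bool_def split: if_splits)
      with comp[of 1] have e: "mat_unit n 0 1 \<in> S" by simp
      have "mat n n (\<lambda>(i, j). if d i - d j = -1 then X $$ (i, j) else 0) = mat_unit n (n - 1) 0"
        using n neq neq[symmetric] by (intro eq_matI) (auto simp: X_def mat_unit_def d_def of_bool_def split: if_splits)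
      with comp[of "-1"] have f: "mat_unit n (n - 1) 0 \<in> S" by simp
      have "mat n n (\<lambda>(i, j). if d i - d j = 0 then X $$ (i, j) else 0) = shift_mat n 1"
        using n by (intro eq_matI) (auto simp: X_def shift_mat_def d_def of_bool_def split: if_splits)
      with comp[of 0] have N: "shift_mat n 1 \<in> S" by simp
      show ?thesis
        using n shift_right[OF S N _ _ e] shift_left[OF S N _ _ f]
        by (intro star_generates_sl[OF S]) auto
    qed
  qed
qed

text \<open>
  Indices \<open>0\<close> and \<open>1\<close> carry the entries \<open>1\<close> and \<open>-1\<close> of the diagonal generator. View a matrix unit
  \<open>E i j\<close> as an edge from \<open>i\<close> to \<open>j\<close>: the edges of \<open>X\<close> must connect \<open>0\<close>, \<open>1\<close> and the path
  \<open>2, \<dots>, n - 1\<close> strongly, and there is no edge between \<open>0\<close> and \<open>1\<close>, which would have weight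
  \<open>2\<close> or \<open>-2\<close>. Of the edges with the same weight, one is at the end of the path where the shift
  continues it and the other where the shift kills it, so that a bracket with the shift isolates
  a matrix unit. The bound on \<open>n\<close> provides the index \<open>3\<close> strictly between the ends of the path.
\<close>

lemma two_generated_sl_ge_5:
  assumes two: "(2::'a::field) \<noteq> 0" and n: "5 \<le> n"
  shows "two_generated n (sl n :: 'a mat set)"
proof -
  define d :: "nat \<Rightarrow> 'a" where "d i = of_bool (i = 0) - of_bool (i = 1)" for i
  define U :: "'a mat" where "U = mat_unit n 0 2 + mat_unit n 2 1"
  define V :: "'a mat" where "V = mat_unit n 1 (n - 1) + mat_unit n (n - 1) 0"
  define X where "X = shift_mat n 2 + U + V"
  have UV: "U \<in> carrier_mat n n" "V \<in> carrier_mat n n"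
    by (simp_all add: U_def V_def)
  have X_index: "X $$ (i, j) = (if 2 \<le> i \<and> j = Suc i \<or> (i, j) \<in> {(0, 2), (2, 1), (1, n - 1), (n - 1, 0)} then 1 else 0)"
    if "i < n" "j < n" for i j
    using that n by (auto simp: X_def U_def V_def shift_mat_def mat_unit_def)
  show ?thesis
  proof (rule two_generatedI[OF lie_subalgebra_sl])
    show "X \<in> sl n"
    proof -
      have X: "X \<in> carrier_mat n n"
        using UV by (simp add: X_def)
      moreover have "(\<Sum>i<n. X $$ (i, i)) = 0"
        using n by (intro sum.neutral ballI) (simp add: X_index, arith)
      ultimately show ?thesis
        by (simp add: sl_def mat_trace_def)
    qed
    have "(\<Sum>i<n. d i) = 0"
      using n by (simp add: d_def sum_subtractf of_bool_def)
    then show "mat_diag n d \<in> sl n"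
      by (simp add: sl_def mat_trace_diagonal)
    show "sl n \<subseteq> S" if S: "lie_subalgebra n S" and x: "X \<in> S" and y: "mat_diag n d \<in> S" for S
    proof -
      have comp: "mat n n (\<lambda>(i, j). if d i - d j = w then X $$ (i, j) else 0) \<in> S"
        if "w \<in> {-1, 0, 1}" for w
        using that n by (intro weight_components[OF S two y x]) (auto simp: d_def X_index split: if_splits)
      have neq: "(1::'a) \<noteq> -1"
        using two by (metis add.right_inverse one_add_one)
      have "mat n n (\<lambda>(i, j). if d i - d j = 1 then X $$ (i, j) else 0) = U"
        using n neq neq[symmetric]
        by (intro eq_matI) (auto simp: X_index U_def mat_unit_def d_def of_bool_def split: if_splits)
      with comp[of 1] have U: "U \<in> S" by simp
      have "mat n n (\<lambda>(i, j). if d i - d j = -1 then X $$ (i, j) else 0) = V"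
        using n neq neq[symmetric]
        by (intro eq_matI) (auto simp: X_index V_def mat_unit_def d_def of_bool_def split: if_splits)
      with comp[of "-1"] have V: "V \<in> S" by simp
      have "mat n n (\<lambda>(i, j). if d i - d j = 0 then X $$ (i, j) else 0) = shift_mat n 2"
        using n by (intro eq_matI) (auto simp: X_index shift_mat_def d_def of_bool_def split: if_splits)
      with comp[of 0] have N: "shift_mat n 2 \<in> S" by simp
      have U_N: "lie_bracket U (shift_mat n 2) = mat_unit n 0 3"
        using n unfolding U_def
        by (subst lie_bracket_add_left[of _ n], simp, simp, simp)
          (intro eq_matI, simp_all add: lie_bracket_mat_unit_index, auto simp: shift_mat_def mat_unit_def)
      have V_N: "(-1) \<cdot>\<^sub>m lie_bracket V (shift_mat n 2) = mat_unit n (n - 2) 0"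
        using n unfolding V_def
        by (subst lie_bracket_add_left[of _ n], simp, simp, simp)
          (intro eq_matI, simp_all add: lie_bracket_mat_unit_index, auto simp: shift_mat_def mat_unit_def)
      have e3: "mat_unit n 0 3 \<in> S"
        using subalgebra_bracket[OF S U N] U_N by simp
      have fn2: "mat_unit n (n - 2) 0 \<in> S"
        using subalgebra_smult[OF S subalgebra_bracket[OF S V N]] V_N by metis
      have f3: "mat_unit n 3 0 \<in> S"
        using n by (intro shift_left[OF S N _ _ fn2]) auto
      \<comment> \<open>As \<open>3\<close> is not an end of the path, \<open>H\<close> acts on \<open>E 0 2\<close> and \<open>E (n - 1) 0\<close> by \<open>1\<close> and \<open>-1\<close>
         and kills the other summands of \<open>U\<close> and \<open>V\<close>.\<close>
      define H :: "'a mat" where "H = lie_bracket (mat_unit n 0 3) (mat_unit n 3 0)"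
      have H: "H \<in> S"
        unfolding H_def by (rule subalgebra_bracket[OF S e3 f3])
      have H_diag: "H = mat_diag n (\<lambda>i. of_bool (i = 0) - of_bool (i = 3))"
        unfolding H_def using n
        by (intro eq_matI) (simp_all add: lie_bracket_mat_unit_index, auto simp: mat_unit_def mat_diag_def)
      have "lie_bracket H U = mat_unit n 0 2"
        using n UV unfolding H_diag
        by (intro eq_matI) (simp_all add: lie_bracket_diagonal_index, auto simp: U_def mat_unit_def)
      then have e2: "mat_unit n 0 2 \<in> S"
        using subalgebra_bracket[OF S H U] by simp
      have "(-1) \<cdot>\<^sub>m lie_bracket H V = mat_unit n (n - 1) 0"
        using n UV unfolding H_diag
        by (intro eq_matI) (simp_all add: lie_bracket_diagonal_index, auto simp: V_def mat_unit_def)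
      then have fn1: "mat_unit n (n - 1) 0 \<in> S"
        using subalgebra_smult[OF S subalgebra_bracket[OF S H V]] by metis
      have "lie_bracket (mat_unit n 0 2) U = mat_unit n 0 1"
        using n UV
        by (intro eq_matI) (simp_all add: lie_bracket_mat_unit_index, auto simp: U_def mat_unit_def)
      then have e1: "mat_unit n 0 1 \<in> S"
        using subalgebra_bracket[OF S e2 U] by simp
      have "(-1) \<cdot>\<^sub>m lie_bracket (mat_unit n (n - 1) 0) V = mat_unit n 1 0"
        using n UV
        by (intro eq_matI) (simp_all add: lie_bracket_mat_unit_index, auto simp: V_def mat_unit_def)
      then have f1: "mat_unit n 1 0 \<in> S"
        using subalgebra_smult[OF S subalgebra_bracket[OF S fn1 V]] by metis
      show ?thesis
      proof (rule star_generates_sl[OF S])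
        show "mat_unit n 0 j \<in> S" if "0 < j" "j < n" for j
          using that e1 shift_right[OF S N _ _ e2, of j] by (cases "j = 1") auto
        show "mat_unit n i 0 \<in> S" if "0 < i" "i < n" for i
          using that f1 shift_left[OF S N _ _ fn1, of i] by (cases "i = 1") auto
      qed
    qed
  qed
qed

theorem corollary4p6:
  fixes n :: nat
  assumes "CHAR('a::finite_field) \<noteq> 2"
    and "n > 0"
    and "(n, CHAR('a)) \<noteq> (3, 3)"
  shows "two_generated n (sl n :: 'a mat set)"
proof -
  have prime: "prime CHAR('a)"
    by (rule prime_CHAR_semidom) (rule finite_imp_CHAR_pos, simp)
  have ge3: "3 \<le> CHAR('a)"
    using prime_ge_2_nat[OF prime] assms(1) by simp
  have two: "(2::'a) \<noteq> 0"
    using ge3 of_nat_eq_0_iff_char_dvd[of 2, where 'a = 'a] by (auto dest: dvd_imp_le)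
  show ?thesis
  proof (cases "5 \<le> n")
    case True
    then show ?thesis by (rule two_generated_sl_ge_5[OF two])
  next
    case False
    have "\<not> CHAR('a) dvd n"
    proof
      assume dvd: "CHAR('a) dvd n"
      then have "CHAR('a) \<le> n" using assms(2) by (rule dvd_imp_le)
      moreover have "CHAR('a) \<noteq> 4"
        using prime_odd_nat[OF prime] ge3 by auto
      ultimately have "CHAR('a) = 3" using ge3 False by linarith
      moreover from this have "n = 3 \<or> n = 4"
        using \<open>CHAR('a) \<le> n\<close> False by linarith
      ultimately show False
        using dvd assms(3) by (elim disjE) simp_all
    qed
    then show ?thesis
      by (intro two_generated_sl_of_degree_nonzero two) (simp add: of_nat_eq_0_iff_char_dvd)
  qed
qed

end
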